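(* Let $A$ and $B$ be Banach algebras with bounded approximate identities and let $(E^{<},E^{>})$ be a Morita equivalence between them. For every closed two-sided ideal $I$ of $B$, $$E_I^{>}=\overline{E^{>}I},\qquad {}_IE^{<}=\overline{IE^{<}}.$$
   Context: All Banach spaces and Banach algebras are complex, and all Banach module actions are contractive. For a subset $S$ of a Banach space, $\overline{\operatorname{span}}\,S$ is its closed linear span. For sets $S,T$ a pairing symbol applied to $(S,T)$ denotes the set of all values on $S\times T$; juxtaposition of linear subspaces (e.g. $E^{>}I$, $IE^{<}$) denotes the linear span of all products, and the bar is norm closure. A bounded approximate identity in a Banach algebra $A$ is a net $(u_\lambda)$ with $\sup_\lambda\|u_\lambda\|<\infty$ and $u_\lambda a\to a$, $au_\lambda\to a$ for every $a\in A$. A Morita equivalence $(E^{<},E^{>})$ between Banach algebras $A$ and $B$ consists of a Banach $B$-$A$-bimodule $E^{<}$, a Banach $A$-$B$-bimodule $E^{>}$, and continuous bilinear pairings $\langle\cdot,\cdot\rangle_B:E^{<}\times E^{>}\to B$ and ${}_A\langle\cdot,\cdot\rangle:E^{>}\times E^{<}\to A$ of norm at most one such that, for all $e^{<},f^{<}\in E^{<}$, $e^{>},f^{>}\in E^{>}$, $a\in A$, $b\in B$: (i) $\langle be^{<},e^{>}\rangle_B=b\langle e^{<},e^{>}\rangle_B$, $\langle e^{<},e^{>}b\rangle_B=\langle e^{<},e^{>}\rangle_Bb$, ${}_A\langle ae^{>},e^{<}\rangle=a\,{}_A\langle e^{>},e^{<}\rangle$, ${}_A\langle e^{>},e^{<}a\rangle={}_A\langle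 e^{>},e^{<}\rangle a$; (ii) $\langle e^{<}a,e^{>}\rangle_B=\langle e^{<},ae^{>}\rangle_B$, ${}_A\langle e^{>}b,e^{<}\rangle={}_A\langle e^{>},be^{<}\rangle$; (iii) $\langle e^{<},e^{>}\rangle_Bf^{<}=e^{<}\,{}_A\langle e^{>},f^{<}\rangle$, $e^{>}\langle f^{<},f^{>}\rangle_B={}_A\langle e^{>},f^{<}\rangle f^{>}$; (iv) both pairings are full: $\overline{\operatorname{span}}\,\langle E^{<},E^{>}\rangle_B=B$ and $\overline{\operatorname{span}}\,{}_A\langle E^{>},E^{<}\rangle=A$; (v) all four module actions are nondegenerate, i.e. the linear span of the module products is dense in the module. For a closed two-sided ideal $I$ of $B$ put $E_I^{>}=\{\xi\in E^{>}:\langle\eta,\xi\rangle_B\in I\ \forall\eta\in E^{<}\}$ and ${}_IE^{<}=\{\eta\in E^{<}:\langle\eta,\xi\rangle_B\in I\ \forall\xi\in E^{>}\}$. *)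

theory Defs
  imports "HOL-Analysis.Analysis"
begin

text \<open>HOL-Analysis has only real normed spaces and algebras.  The classes below put a complex
  scalar multiplication, compatible with the real one, on top of them.  Algebras need
  not be unital, and the zero space and the zero algebra are allowed.\<close>

class complex_normed_vector = real_normed_vector +
  fixes scaleC :: "complex \<Rightarrow> 'a \<Rightarrow> 'a" (infixr \<open>*\<^sub>C\<close> 75)
  assumes scaleC_add_right: "c *\<^sub>C (x + y) = c *\<^sub>C x + c *\<^sub>C y"
    and scaleC_add_left: "(c + d) *\<^sub>C x = c *\<^sub>C x + d *\<^sub>C x"
    and scaleC_scaleC: "c *\<^sub>C d *\<^sub>C x = (c * d) *\<^sub>C x"
    and scaleC_of_real: "complex_of_real r *\<^sub>C x = r *\<^sub>R x"
    and norm_scaleC: "norm (c *\<^sub>C x) = cmod c * norm x"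

class complex_banach = complex_normed_vector + complete_space

class complex_banach_algebra = complex_banach + real_normed_algebra +
  assumes mult_scaleC_left: "(c *\<^sub>C x) * y = c *\<^sub>C (x * y)"
    and mult_scaleC_right: "x * (c *\<^sub>C y) = c *\<^sub>C (x * y)"

instantiation complex :: complex_banach_algebra
begin

definition scaleC_complex :: "complex \<Rightarrow> complex \<Rightarrow> complex"
  where "scaleC_complex c z = c * z"

instance
proof
  fix r :: real and x :: complex
  show "complex_of_real r *\<^sub>C x = r *\<^sub>R x"
    unfolding scaleC_complex_def by (rule scaleR_conv_of_real[symmetric])
qed (simp_all add: scaleC_complex_def distrib_left distrib_right norm_mult mult.assoc mult.left_commute)

end

global_interpretation complex_vector:
  vector_space "scaleC :: complex \<Rightarrow> 'a \<Rightarrow> 'a::complex_normed_vector"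
  defines csubspace = complex_vector.subspace
    and cspan = complex_vector.span
proof
  show "1 *\<^sub>C x = x" for x :: 'a
    using scaleC_of_real[of 1 x] by simp
qed (simp_all add: scaleC_add_right scaleC_add_left scaleC_scaleC)

text \<open>The linear span of all values \<open>f x y\<close> with \<open>x \<in> S\<close> and \<open>y \<in> T\<close>.  For a module
  action \<open>f\<close> this is the juxtaposition \<open>S T\<close> of subspaces.\<close>

definition cspan_values ::
    "('x \<Rightarrow> 'y \<Rightarrow> 'z::complex_normed_vector) \<Rightarrow> 'x set \<Rightarrow> 'y set \<Rightarrow> 'z set"
  where "cspan_values f S T = cspan (case_prod f ` (S \<times> T))"

locale contractive_cbilinear =
  fixes f :: "'x::complex_normed_vector \<Rightarrow> 'y::complex_normed_vector \<Rightarrow> 'z::complex_normed_vector"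
  assumes add_left: "f (x + x') y = f x y + f x' y"
    and add_right: "f x (y + y') = f x y + f x y'"
    and scaleC_left: "f (c *\<^sub>C x) y = c *\<^sub>C f x y"
    and scaleC_right: "f x (c *\<^sub>C y) = c *\<^sub>C f x y"
    and contractive: "norm (f x y) \<le> norm x * norm y"

locale banach_bimodule =
  left: contractive_cbilinear lact + right: contractive_cbilinear ract
  for lact :: "'r::complex_banach_algebra \<Rightarrow> 'm::complex_banach \<Rightarrow> 'm" (infixr \<open>\<rhd>\<close> 72)
    and ract :: "'m \<Rightarrow> 's::complex_banach_algebra \<Rightarrow> 'm" (infixl \<open>\<lhd>\<close> 72) +
  assumes left_assoc: "(r * r') \<rhd> m = r \<rhd> (r' \<rhd> m)"
    and right_assoc: "m \<lhd> (s * s') = (m \<lhd> s) \<lhd> s'"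
    and left_right: "(r \<rhd> m) \<lhd> s = r \<rhd> (m \<lhd> s)"

text \<open>Here \<open>'e\<close> is the \<open>'b\<close>-\<open>'a\<close>-bimodule \<open>E\<^sup><\<close> with actions \<open>lB\<close>, \<open>rA\<close>, and \<open>'f\<close> is
  the \<open>'a\<close>-\<open>'b\<close>-bimodule \<open>E\<^sup>>\<close> with actions \<open>lA\<close>, \<open>rB\<close>.\<close>

locale morita_equivalence =
  lt: banach_bimodule lB rA + gt: banach_bimodule lA rB +
  pairB: contractive_cbilinear pB + pairA: contractive_cbilinear pA
  for lB :: "'b::complex_banach_algebra \<Rightarrow> 'e::complex_banach \<Rightarrow> 'e"
    and rA :: "'e \<Rightarrow> 'a::complex_banach_algebra \<Rightarrow> 'e"
    and lA :: "'a \<Rightarrow> 'f::complex_banach \<Rightarrow> 'f"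
    and rB :: "'f \<Rightarrow> 'b \<Rightarrow> 'f"
    and pB :: "'e \<Rightarrow> 'f \<Rightarrow> 'b"
    and pA :: "'f \<Rightarrow> 'e \<Rightarrow> 'a" +
  assumes pB_left: "pB (lB b e) f = b * pB e f"
    and pB_right: "pB e (rB f b) = pB e f * b"
    and pA_left: "pA (lA a f) e = a * pA f e"
    and pA_right: "pA f (rA e a) = pA f e * a"
    and pB_balanced: "pB (rA e a) f = pB e (lA a f)"
    and pA_balanced: "pA (rB f b) e = pA f (lB b e)"
    and compat_lt: "lB (pB e f) e' = rA e (pA f e')"
    and compat_gt: "rB f (pB e f') = lA (pA f e) f'"
    and pB_full: "closure (cspan_values pB UNIV UNIV) = UNIV"
    and pA_full: "closure (cspan_values pA UNIV UNIV) = UNIV"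
    and lB_nondegenerate: "closure (cspan_values lB UNIV UNIV) = UNIV"
    and rA_nondegenerate: "closure (cspan_values rA UNIV UNIV) = UNIV"
    and lA_nondegenerate: "closure (cspan_values lA UNIV UNIV) = UNIV"
    and rB_nondegenerate: "closure (cspan_values rB UNIV UNIV) = UNIV"

definition directed_set :: "'i set \<Rightarrow> ('i \<Rightarrow> 'i \<Rightarrow> bool) \<Rightarrow> bool"
  where "directed_set \<Lambda> le \<longleftrightarrow> \<Lambda> \<noteq> {} \<and> reflp_on \<Lambda> le \<and> transp_on \<Lambda> le \<and>
    (\<forall>i\<in>\<Lambda>. \<forall>j\<in>\<Lambda>. \<exists>k\<in>\<Lambda>. le i k \<and> le j k)"

text \<open>The filter generated by the tails of a directed set; convergence of a net is
  convergence along this filter.\<close>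

definition tails :: "'i set \<Rightarrow> ('i \<Rightarrow> 'i \<Rightarrow> bool) \<Rightarrow> 'i filter"
  where "tails \<Lambda> le = (INF i\<in>\<Lambda>. principal {j\<in>\<Lambda>. le i j})"

lemma eventually_tails:
  assumes "directed_set \<Lambda> le"
  shows "eventually P (tails \<Lambda> le) \<longleftrightarrow> (\<exists>i\<in>\<Lambda>. \<forall>j\<in>\<Lambda>. le i j \<longrightarrow> P j)"
proof -
  have ne: "\<Lambda> \<noteq> {}" and tr: "transp_on \<Lambda> le"
    and ub: "\<And>i j. i \<in> \<Lambda> \<Longrightarrow> j \<in> \<Lambda> \<Longrightarrow> \<exists>k\<in>\<Lambda>. le i k \<and> le j k"
    using assms unfolding directed_set_def by blast+
  have base: "\<exists>k\<in>\<Lambda>. principal {l\<in>\<Lambda>. le k l} \<le> inf (principal {l\<in>\<Lambda>. le i l}) (principal {l\<in>\<Lambda>. le j l})"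
    if ij: "i \<in> \<Lambda>" "j \<in> \<Lambda>" for i j
  proof -
    obtain k where k: "k \<in> \<Lambda>" "le i k" "le j k"
      using ub[OF ij] by blast
    have "{l\<in>\<Lambda>. le k l} \<subseteq> {l\<in>\<Lambda>. le i l} \<inter> {l\<in>\<Lambda>. le j l}"
      using transp_onD[OF tr ij(1) k(1)] transp_onD[OF tr ij(2) k(1)] k(2,3) by blast
    then have "principal {l\<in>\<Lambda>. le k l} \<le> inf (principal {l\<in>\<Lambda>. le i l}) (principal {l\<in>\<Lambda>. le j l})"
      unfolding inf_principal by (simp only: principal_le_iff)
    with k(1) show ?thesis ..
  qed
  have "eventually P (tails \<Lambda> le) \<longleftrightarrow> (\<exists>i\<in>\<Lambda>. eventually P (principal {j\<in>\<Lambda>. le i j}))"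
    unfolding tails_def by (rule eventually_INF_base[OF ne]) (rule base)
  then show ?thesis
    unfolding eventually_principal by blast
qed

definition bounded_approximate_identity ::
    "'i set \<Rightarrow> ('i \<Rightarrow> 'i \<Rightarrow> bool) \<Rightarrow> ('i \<Rightarrow> 'a::complex_banach_algebra) \<Rightarrow> bool"
  where "bounded_approximate_identity \<Lambda> le u \<longleftrightarrow>
    directed_set \<Lambda> le \<and> bounded (u ` \<Lambda>) \<and>
    (\<forall>a. ((\<lambda>i. u i * a) \<longlongrightarrow> a) (tails \<Lambda> le) \<and> ((\<lambda>i. a * u i) \<longlongrightarrow> a) (tails \<Lambda> le))"

definition closed_two_sided_ideal :: "'b::complex_banach_algebra set \<Rightarrow> bool"
  where "closed_two_sided_ideal I \<longleftrightarrow>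
    csubspace I \<and> closed I \<and> (\<forall>x\<in>I. \<forall>b. b * x \<in> I \<and> x * b \<in> I)"

definition ideal_gt :: "('e \<Rightarrow> 'f \<Rightarrow> 'b) \<Rightarrow> 'b set \<Rightarrow> 'f set"
  where "ideal_gt pB I = {\<xi>. \<forall>\<eta>. pB \<eta> \<xi> \<in> I}"

definition ideal_lt :: "('e \<Rightarrow> 'f \<Rightarrow> 'b) \<Rightarrow> 'b set \<Rightarrow> 'e set"
  where "ideal_lt pB I = {\<eta>. \<forall>\<xi>. pB \<eta> \<xi> \<in> I}"

end

theory Submission
  imports Defs
begin

text \<open>If \<open>\<xi>\<close> lies in \<open>E\<^sub>I\<^sup>>\<close>, then \<open>a = pA f e\<close> acts by \<open>a \<xi> = f (pB e \<xi>)\<close>, which is in \<open>E\<^sup>> I\<close>.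
  By fullness and continuity \<open>a \<xi>\<close> lies in the closure of \<open>E\<^sup>> I\<close> for every \<open>a\<close>. Letting \<open>a\<close> run
  through a bounded approximate identity of \<open>A\<close>, which converges strongly to the identity on the
  nondegenerate module \<open>E\<^sup>>\<close>, gives the nontrivial inclusion. The argument for \<open>E\<^sup><\<close> is the
  mirror image and uses the same approximate identity of \<open>A\<close>.\<close>

text \<open>Since \<open>scaleC_of_real\<close> identifies real scalars with complex ones, which
  commute with \<open>c\<close>, multiplication by \<open>c\<close> is real-linear and bounded by
  \<open>cmod c\<close>.\<close>

lemma continuous_on_scaleC: "continuous_on UNIV (\<lambda>x::'a::complex_normed_vector. c *\<^sub>C x)"
proof -
  have "bounded_linear (\<lambda>x::'a. c *\<^sub>C x)"
  proof (rule bounded_linear_intro)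
    fix r and x y :: 'a
    show "c *\<^sub>C (x + y) = c *\<^sub>C x + c *\<^sub>C y"
      by (rule scaleC_add_right)
    show "c *\<^sub>C (r *\<^sub>R x) = r *\<^sub>R (c *\<^sub>C x)"
      by (simp add: scaleC_of_real[symmetric] scaleC_scaleC mult.commute)
    show "norm (c *\<^sub>C x) \<le> norm x * cmod c"
      by (simp add: norm_scaleC)
  qed
  then show ?thesis
    by (rule linear_continuous_on)
qed

lemma csubspace_closure:
  fixes S :: "'a::complex_normed_vector set"
  assumes "csubspace S"
  shows "csubspace (closure S)"
proof (rule complex_vector.subspaceI)
  show "0 \<in> closure S"
    using assms closure_subset complex_vector.subspace_0 by blast
next
  fix x y assume "x \<in> closure S" "y \<in> closure S"
  then obtain X Y where "\<forall>n. X n \<in> S" "X \<longlonglongrightarrow> x" "\<forall>n. Y n \<in> S" "Y \<longlonglongrightarrow> y"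
    unfolding closure_sequential by blast
  then have "(\<forall>n. X n + Y n \<in> S) \<and> (\<lambda>n. X n + Y n) \<longlonglongrightarrow> x + y"
    using assms complex_vector.subspace_add tendsto_add by blast
  then show "x + y \<in> closure S"
    unfolding closure_sequential by (intro exI[of _ "\<lambda>n. X n + Y n"])
next
  fix c x assume "x \<in> closure S"
  moreover have "(\<lambda>x. c *\<^sub>C x) ` closure S \<subseteq> closure S"
  proof (rule image_closure_subset)
    show "continuous_on (closure S) (\<lambda>x. c *\<^sub>C x)"
      using continuous_on_scaleC by (rule continuous_on_subset) simp
    show "(\<lambda>x. c *\<^sub>C x) ` S \<subseteq> closure S"
      using assms complex_vector.subspace_scale closure_subset by fast
  qed simp
  ultimately show "c *\<^sub>C x \<in> closure S"
    by blast
qed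

lemma csubspace_cspan_values: "csubspace (cspan_values f S T)"
  unfolding cspan_values_def by (rule complex_vector.subspace_span)

lemma cspan_values_memI: "x \<in> S \<Longrightarrow> y \<in> T \<Longrightarrow> f x y \<in> cspan_values f S T"
  unfolding cspan_values_def by (rule complex_vector.span_base) auto

lemma cspan_values_subset:
  assumes "csubspace V" and "\<And>x y. x \<in> S \<Longrightarrow> y \<in> T \<Longrightarrow> f x y \<in> V"
  shows "cspan_values f S T \<subseteq> V"
  unfolding cspan_values_def by (rule complex_vector.span_minimal) (use assms in auto)

lemma closure_cspan_values_subset:
  assumes "csubspace V" "closed V" and "\<And>x y. x \<in> S \<Longrightarrow> y \<in> T \<Longrightarrow> f x y \<in> V"
  shows "closure (cspan_values f S T) \<subseteq> V"
  using assms by (intro closure_minimal cspan_values_subset)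

text \<open>The lemmas below on preimages and on actions vary the first argument; the flip carries
  them over to the right action \<open>rA\<close> and to the second variable of
  \<open>pB\<close>.\<close>

lemma contractive_cbilinear_flip:
  assumes "contractive_cbilinear f"
  shows "contractive_cbilinear (\<lambda>x y. f y x)"
proof -
  interpret contractive_cbilinear f
    by (fact assms)
  show ?thesis
  proof
    show "norm (f y x) \<le> norm x * norm y" for x y
      using contractive[of y x] by (simp only: mult.commute)
  qed (simp_all only: add_left add_right scaleC_left scaleC_right)
qed

context contractive_cbilinear
begin

lemma bounded_bilinear: "bounded_bilinear f"
proof
  fix r x x' y y'
  show "f (x + x') y = f x y + f x' y" "f x (y + y') = f x y + f x y'"
    by (rule add_left add_right)+
  show "f (r *\<^sub>R x) y = r *\<^sub>R f x y" "f x (r *\<^sub>R y) = r *\<^sub>R f x y"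
    by (simp_all add: scaleC_of_real[symmetric] scaleC_left scaleC_right)
  show "\<exists>K. \<forall>x y. norm (f x y) \<le> norm x * norm y * K"
    using contractive by (intro exI[of _ 1]) simp
qed

lemma csubspace_vimage:
  assumes "csubspace V"
  shows "csubspace {x. f x y \<in> V}"
  using assms bounded_bilinear.zero_left[OF bounded_bilinear]
  by (intro complex_vector.subspaceI)
    (auto simp: add_left scaleC_left complex_vector.subspace_0 complex_vector.subspace_add
      complex_vector.subspace_scale)

lemma closed_vimage:
  assumes "closed V"
  shows "closed {x. f x y \<in> V}"
proof -
  have "continuous_on UNIV (\<lambda>x. f x y)"
    by (intro linear_continuous_on bounded_bilinear.bounded_linear_left[OF bounded_bilinear])
  then show ?thesis
    using continuous_on_closed_vimage[of UNIV "\<lambda>x. f x y"] assms by (auto simp: vimage_def)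
qed

end

text \<open>Strong convergence to the identity passes from \<open>S\<close> to its span by
  linearity, and from the span to its closure because the operators given by \<open>u i\<close> are
  eventually uniformly bounded.\<close>

lemma tendsto_of_dense_span:
  fixes act :: "'r::complex_normed_vector \<Rightarrow> 'm::complex_normed_vector \<Rightarrow> 'm"
  assumes act: "contractive_cbilinear act"
    and bdd: "\<forall>\<^sub>F i in F. norm (u i) \<le> K"
    and gen: "\<And>m. m \<in> S \<Longrightarrow> ((\<lambda>i. act (u i) m) \<longlongrightarrow> m) F"
    and dense: "closure (cspan S) = UNIV"
  shows "((\<lambda>i. act (u i) m) \<longlongrightarrow> m) F"
proof -
  interpret contractive_cbilinear act
    by (fact act)
  interpret bounded_bilinear act
    by (fact bounded_bilinear)
  have "csubspace {m. ((\<lambda>i. act (u i) m) \<longlongrightarrow> m) F}"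
  proof (rule complex_vector.subspaceI; clarify)
    show "((\<lambda>i. act (u i) 0) \<longlongrightarrow> 0) F"
      by (simp add: zero_right)
    show "((\<lambda>i. act (u i) (x + y)) \<longlongrightarrow> x + y) F"
      if "((\<lambda>i. act (u i) x) \<longlongrightarrow> x) F" "((\<lambda>i. act (u i) y) \<longlongrightarrow> y) F" for x y
      using tendsto_add[OF that] by (simp add: add_right)
    show "((\<lambda>i. act (u i) (c *\<^sub>C x)) \<longlongrightarrow> c *\<^sub>C x) F"
      if "((\<lambda>i. act (u i) x) \<longlongrightarrow> x) F" for c x
      using continuous_on_tendsto_compose[OF continuous_on_scaleC that, of c] by (simp add: scaleC_right)
  qed
  with gen have span: "cspan S \<subseteq> {m. ((\<lambda>i. act (u i) m) \<longlongrightarrow> m) F}"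
    by (intro complex_vector.span_minimal) auto
  show ?thesis
  proof (rule tendstoI)
    fix e :: real assume "e > 0"
    \<comment> \<open>The absolute value keeps \<open>L\<close> positive whatever the sign of
      \<open>K\<close>; the summand 1 absorbs the extra distance from \<open>m'\<close> to
      \<open>m\<close> in the estimate below.\<close>
    define L where "L = \<bar>K\<bar> + 1"
    have "L > 0" and "K \<le> L - 1"
      unfolding L_def by simp_all
    obtain m' where m': "m' \<in> cspan S" "dist m' m < e / (2 * L)"
      using closure_approachable[of m "cspan S"] dense \<open>e > 0\<close> \<open>L > 0\<close>
      by (auto dest: spec[where x = "e / (2 * L)"])
    from m'(1) span have "((\<lambda>i. act (u i) m') \<longlongrightarrow> m') F"
      by blast
    then have "\<forall>\<^sub>F i in F. dist (act (u i) m') m' < e / 2"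
      using \<open>e > 0\<close> by (intro tendstoD) auto
    with bdd show "\<forall>\<^sub>F i in F. dist (act (u i) m) m < e"
    proof eventually_elim
      case (elim i)
      have "norm (act (u i) (m - m')) \<le> norm (u i) * norm (m - m')"
        by (rule contractive)
      also have "\<dots> \<le> (L - 1) * norm (m - m')"
        using elim(1) \<open>K \<le> L - 1\<close> by (intro mult_right_mono) auto
      \<comment> \<open>Of the three terms on the path from \<open>act (u i) m\<close> through
        \<open>act (u i) m'\<close> and \<open>m'\<close> to \<open>m\<close>, the two outer ones
        are bounded together here; the middle one is \<open>elim(2)\<close>.\<close>
      finally have "norm (act (u i) m - act (u i) m') + dist m' m \<le> L * dist m' m"
        by (simp add: diff_right dist_norm norm_minus_commute algebra_simps)
      also have "\<dots> < e / 2"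
        using m'(2) \<open>L > 0\<close> by (simp add: field_simps)
      finally have "dist (act (u i) m) (act (u i) m') + dist m' m < e / 2"
        by (simp add: dist_norm)
      with elim(2) show ?case
        using dist_triangle[of "act (u i) m" m "act (u i) m'"] dist_triangle[of "act (u i) m'" m m']
        by linarith
    qed
  qed
qed

text \<open>By reflexivity each tail contains its own index, so none is empty. Properness of the
  filter is what keeps limits of nets inside closed sets.\<close>

lemma tails_neq_bot: "directed_set \<Lambda> le \<Longrightarrow> tails \<Lambda> le \<noteq> bot"
  using eventually_tails[of \<Lambda> le "\<lambda>_. False"]
  by (auto simp: trivial_limit_def directed_set_def reflp_on_def)

lemma bounded_approximate_identity_bound:
  assumes "bounded_approximate_identity \<Lambda> le u"
  obtains K where "\<forall>\<^sub>F i in tails \<Lambda> le. norm (u i) \<le> K"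
proof -
  from assms obtain K where K: "\<And>i. i \<in> \<Lambda> \<Longrightarrow> norm (u i) \<le> K" and d: "directed_set \<Lambda> le"
    unfolding bounded_approximate_identity_def bounded_iff by auto
  then have "\<forall>\<^sub>F i in tails \<Lambda> le. norm (u i) \<le> K"
    unfolding eventually_tails[OF d] directed_set_def by blast
  then show thesis
    by (rule that)
qed

text \<open>The scalars that send \<open>m\<close> into \<open>V\<close> form a closed subspace
  containing all values of \<open>p\<close>, hence everything by fullness. Thus every
  \<open>act (u i) m\<close> lies in \<open>V\<close>, and so does the limit
  \<open>m\<close>.\<close>

lemma mem_closed_csubspace_by_action:
  assumes act: "contractive_cbilinear act" and V: "csubspace V" "closed V"
    and F: "F \<noteq> bot" "((\<lambda>i. act (u i) m) \<longlongrightarrow> m) F"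
    and full: "closure (cspan_values p UNIV UNIV) = UNIV"
    and p: "\<And>x y. act (p x y) m \<in> V"
  shows "m \<in> V"
proof -
  interpret contractive_cbilinear act
    by (fact act)
  have "closure (cspan_values p UNIV UNIV) \<subseteq> {a. act a m \<in> V}"
    by (rule closure_cspan_values_subset) (use csubspace_vimage[OF V(1)] closed_vimage[OF V(2)] p in auto)
  then have "act (u i) m \<in> V" for i
    unfolding full by blast
  then show ?thesis
    by (intro Lim_in_closed_set[OF V(2) _ F]) simp
qed

theorem proposition2p4:
  fixes lB :: "'b::complex_banach_algebra \<Rightarrow> 'e::complex_banach \<Rightarrow> 'e"
    and rA :: "'e \<Rightarrow> 'a::complex_banach_algebra \<Rightarrow> 'e"
    and lA :: "'a \<Rightarrow> 'f::complex_banach \<Rightarrow> 'f"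
    and rB :: "'f \<Rightarrow> 'b \<Rightarrow> 'f"
    and pB :: "'e \<Rightarrow> 'f \<Rightarrow> 'b"
    and pA :: "'f \<Rightarrow> 'e \<Rightarrow> 'a"
    and \<Lambda>\<^sub>A :: "'i set" and le\<^sub>A :: "'i \<Rightarrow> 'i \<Rightarrow> bool" and u :: "'i \<Rightarrow> 'a"
    and \<Lambda>\<^sub>B :: "'j set" and le\<^sub>B :: "'j \<Rightarrow> 'j \<Rightarrow> bool" and v :: "'j \<Rightarrow> 'b"
    and I :: "'b set"
  assumes "bounded_approximate_identity \<Lambda>\<^sub>A le\<^sub>A u"
    and "bounded_approximate_identity \<Lambda>\<^sub>B le\<^sub>B v"
    and "morita_equivalence lB rA lA rB pB pA"
    and "closed_two_sided_ideal I"
  shows "ideal_gt pB I = closure (cspan_values rB UNIV I) \<and>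
    ideal_lt pB I = closure (cspan_values lB I UNIV)"
proof -
  interpret morita_equivalence lB rA lA rB pB pA
    by (fact assms(3))
  have I: "csubspace I" "closed I" "\<And>x b. x \<in> I \<Longrightarrow> b * x \<in> I" "\<And>x b. x \<in> I \<Longrightarrow> x * b \<in> I"
    using assms(4) unfolding closed_two_sided_ideal_def by auto
  have u: "tails \<Lambda>\<^sub>A le\<^sub>A \<noteq> bot" "\<And>a. ((\<lambda>i. u i * a) \<longlongrightarrow> a) (tails \<Lambda>\<^sub>A le\<^sub>A)"
    "\<And>a. ((\<lambda>i. a * u i) \<longlongrightarrow> a) (tails \<Lambda>\<^sub>A le\<^sub>A)"
    using assms(1) tails_neq_bot unfolding bounded_approximate_identity_def by blast+
  obtain K where K: "\<forall>\<^sub>F i in tails \<Lambda>\<^sub>A le\<^sub>A. norm (u i) \<le> K"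
    using assms(1) by (rule bounded_approximate_identity_bound)
  note rA_flip = contractive_cbilinear_flip[OF lt.right.contractive_cbilinear_axioms]
  note pB_flip = contractive_cbilinear_flip[OF pairB.contractive_cbilinear_axioms]

  have lim_gt: "((\<lambda>i. lA (u i) \<xi>) \<longlongrightarrow> \<xi>) (tails \<Lambda>\<^sub>A le\<^sub>A)" for \<xi>
  proof (rule tendsto_of_dense_span[OF gt.left.contractive_cbilinear_axioms K])
    show "closure (cspan (case_prod lA ` (UNIV \<times> UNIV))) = UNIV"
      using lA_nondegenerate unfolding cspan_values_def .
    \<comment> \<open>On a product, \<open>lA (u i) (lA a x)\<close> equals
      \<open>lA (u i * a) x\<close>, so the left half of the approximate identity suffices.\<close>
    show "((\<lambda>i. lA (u i) m) \<longlongrightarrow> m) (tails \<Lambda>\<^sub>A le\<^sub>A)" if "m \<in> case_prod lA ` (UNIV \<times> UNIV)" for m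
      using that bounded_bilinear.tendsto[OF gt.left.bounded_bilinear u(2) tendsto_const]
      by (auto simp: gt.left_assoc[symmetric])
  qed
  have lim_lt: "((\<lambda>i. rA \<eta> (u i)) \<longlongrightarrow> \<eta>) (tails \<Lambda>\<^sub>A le\<^sub>A)" for \<eta>
  proof (rule tendsto_of_dense_span[OF rA_flip K])
    show "closure (cspan (case_prod rA ` (UNIV \<times> UNIV))) = UNIV"
      using rA_nondegenerate unfolding cspan_values_def .
    \<comment> \<open>Here \<open>rA (rA x a) (u i)\<close> equals \<open>rA x (a * u i)\<close>,
      which calls for the right half.\<close>
    show "((\<lambda>i. rA m (u i)) \<longlongrightarrow> m) (tails \<Lambda>\<^sub>A le\<^sub>A)" if "m \<in> case_prod rA ` (UNIV \<times> UNIV)" for m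
      using that bounded_bilinear.tendsto[OF lt.right.bounded_bilinear tendsto_const u(3)]
      by (auto simp: lt.right_assoc[symmetric])
  qed

  \<comment> \<open>For each fixed test vector the condition cuts out a closed subspace, so the easy
    inclusions need checking only on generators: \<open>pB \<eta> (rB x b) = pB \<eta> x * b\<close>
    and \<open>pB (lB b x) \<xi> = b * pB x \<xi>\<close> lie in the ideal when \<open>b\<close>
    does.\<close>
  have gt_Inter: "ideal_gt pB I = (\<Inter>\<eta>. {\<xi>. pB \<eta> \<xi> \<in> I})"
    and lt_Inter: "ideal_lt pB I = (\<Inter>\<xi>. {\<eta>. pB \<eta> \<xi> \<in> I})"
    unfolding ideal_gt_def ideal_lt_def by auto
  have "closure (cspan_values rB UNIV I) \<subseteq> {\<xi>. pB \<eta> \<xi> \<in> I}" for \<eta>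
    by (rule closure_cspan_values_subset)
      (use I contractive_cbilinear.csubspace_vimage[OF pB_flip I(1)]
         contractive_cbilinear.closed_vimage[OF pB_flip I(2)] in \<open>auto simp: pB_right\<close>)
  moreover have "closure (cspan_values lB I UNIV) \<subseteq> {\<eta>. pB \<eta> \<xi> \<in> I}" for \<xi>
    by (rule closure_cspan_values_subset)
      (use I pairB.csubspace_vimage[OF I(1)] pairB.closed_vimage[OF I(2)] in \<open>auto simp: pB_left\<close>)
  moreover have "\<xi> \<in> closure (cspan_values rB UNIV I)" if "\<xi> \<in> ideal_gt pB I" for \<xi>
  proof (rule mem_closed_csubspace_by_action[OF gt.left.contractive_cbilinear_axioms _ _ u(1) lim_gt pA_full])
    show "lA (pA f e) \<xi> \<in> closure (cspan_values rB UNIV I)" for f e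
      using that closure_subset cspan_values_memI[of f UNIV "pB e \<xi>" I rB]
      by (auto simp: compat_gt[symmetric] ideal_gt_def)
  qed (simp_all add: csubspace_closure csubspace_cspan_values)
  moreover have "\<eta> \<in> closure (cspan_values lB I UNIV)" if "\<eta> \<in> ideal_lt pB I" for \<eta>
  proof (rule mem_closed_csubspace_by_action[OF rA_flip _ _ u(1) lim_lt pA_full])
    \<comment> \<open>By \<open>compat_lt\<close> this vector is \<open>lB (pB \<eta> f) e\<close>,
      whose coefficient \<open>pB \<eta> f\<close> lies in \<open>I\<close> by the choice of
      \<eta>.\<close>
    show "rA \<eta> (pA f e) \<in> closure (cspan_values lB I UNIV)" for f e
      using that closure_subset cspan_values_memI[of "pB \<eta> f" I e UNIV lB]
      by (auto simp: compat_lt[symmetric] ideal_lt_def)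
  qed (simp_all add: csubspace_closure csubspace_cspan_values)
  ultimately show ?thesis
    unfolding gt_Inter lt_Inter by blast
qed

end
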